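(* Let $H$ be a non-trivial abelian group, $K=\langle x\rangle$ an infinite cyclic group, and let $G=H\wr K$ be the standard (restricted) wreath product. Then $P(G)=\{1\}$.
   Context: For a group $G$, the pseudocentre is $P(G)=\bigcap_{x\in G}C_G(x)^G$, where $C_G(x)$ is the centralizer of $x$ in $G$ and, for a subgroup $H\leq G$, $H^G$ is the normal closure of $H$ in $G$. The standard wreath product $H\wr K$ is the semidirect product $K\ltimes B$, where $B=\bigoplus_{k\in K}H_k$ is the direct sum (restricted direct product) of copies $H_k\simeq H$ indexed by $K$, and $K$ permutes the copies by right multiplication on the indices. *)

theory Defs
  imports "HOL-Algebra.Algebra"
begin

definition centralizer :: "('a, 'm) monoid_scheme \<Rightarrow> 'a \<Rightarrow> 'a set"
  where "centralizer G x = {g \<in> carrier G. g \<otimes>\<^bsub>G\<^esub> x = x \<otimes>\<^bsub>G\<^esub> g}"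

definition normal_closure :: "('a, 'm) monoid_scheme \<Rightarrow> 'a set \<Rightarrow> 'a set"
  where "normal_closure G S = \<Inter>{N. N \<lhd> G \<and> S \<subseteq> N}"

definition pseudocentre :: "('a, 'm) monoid_scheme \<Rightarrow> 'a set"
  where "pseudocentre G = (\<Inter>x\<in>carrier G. normal_closure G (centralizer G x))"

text \<open>The semidirect product of \<open>K\<close> and \<open>B\<close> for a right action by automorphisms,
  where \<open>act k b\<close> stands for the conjugate \<open>b\<^sup>k = k\<^sup>-\<^sup>1 b k\<close>. The pair \<open>(k, b)\<close> stands
  for the product \<open>k b\<close>, so that \<open>(k b) (k' b') = (k k') (b\<^sup>k\<^sup>' b')\<close>.\<close>

definition semidirect_product ::
  "('k, 'm) monoid_scheme \<Rightarrow> ('b, 'n) monoid_scheme \<Rightarrow> ('k \<Rightarrow> 'b \<Rightarrow> 'b) \<Rightarrow> ('k \<times> 'b) monoid"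
  where "semidirect_product K B act =
    \<lparr>carrier = carrier K \<times> carrier B,
     monoid.mult = (\<lambda>(k, b) (k', b'). (k \<otimes>\<^bsub>K\<^esub> k', act k' b \<otimes>\<^bsub>B\<^esub> b')),
     one = (\<one>\<^bsub>K\<^esub>, \<one>\<^bsub>B\<^esub>)\<rparr>"

text \<open>\<open>k\<close> moves the copy with index \<open>i\<close> to the copy with index \<open>i k\<close>; hence the component
  of \<open>b\<^sup>k\<close> at \<open>i\<close> is the component of \<open>b\<close> at \<open>i k\<^sup>-\<^sup>1\<close>.\<close>

definition index_shift :: "('k, 'm) monoid_scheme \<Rightarrow> 'k \<Rightarrow> ('k \<Rightarrow> 'h) \<Rightarrow> ('k \<Rightarrow> 'h)"
  where "index_shift K k b = (\<lambda>i\<in>carrier K. b (i \<otimes>\<^bsub>K\<^esub> inv\<^bsub>K\<^esub> k))"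

definition wreath_product ::
  "('h, 'm) monoid_scheme \<Rightarrow> ('k, 'n) monoid_scheme \<Rightarrow> ('k \<times> ('k \<Rightarrow> 'h)) monoid"
  where "wreath_product H K =
    semidirect_product K (sum_group (carrier K) (\<lambda>_. H)) (index_shift K)"

lemma group_semidirect_product:
  assumes "group K" "group B"
    and hom: "\<And>k. k \<in> carrier K \<Longrightarrow> act k \<in> hom B B"
    and act_one: "\<And>b. b \<in> carrier B \<Longrightarrow> act \<one>\<^bsub>K\<^esub> b = b"
    and act_mult: "\<And>k l b. \<lbrakk>k \<in> carrier K; l \<in> carrier K; b \<in> carrier B\<rbrakk>
                      \<Longrightarrow> act (k \<otimes>\<^bsub>K\<^esub> l) b = act l (act k b)"
  shows "group (semidirect_product K B act)"
proof -
  interpret K: group K by fact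
  interpret B: group B by fact
  have closed [simp]: "act k b \<in> carrier B" if "k \<in> carrier K" "b \<in> carrier B" for k b
    using hom[OF that(1)] that(2) by (auto simp: hom_def)
  have mult [simp]: "act k (b \<otimes>\<^bsub>B\<^esub> c) = act k b \<otimes>\<^bsub>B\<^esub> act k c"
    if "k \<in> carrier K" "b \<in> carrier B" "c \<in> carrier B" for k b c
    using hom[OF that(1)] that by (auto simp: hom_def)
  have one [simp]: "act k \<one>\<^bsub>B\<^esub> = \<one>\<^bsub>B\<^esub>" if "k \<in> carrier K" for k
    using hom_one[OF hom[OF that] \<open>group B\<close> \<open>group B\<close>] .
  show ?thesis
  proof (rule groupI)
    fix x assume "x \<in> carrier (semidirect_product K B act)"
    then obtain k b where x: "x = (k, b)" "k \<in> carrier K" "b \<in> carrier B"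
      by (auto simp: semidirect_product_def)
    let ?y = "(inv\<^bsub>K\<^esub> k, act (inv\<^bsub>K\<^esub> k) (inv\<^bsub>B\<^esub> b))"
    have "act k (act (inv\<^bsub>K\<^esub> k) (inv\<^bsub>B\<^esub> b)) = inv\<^bsub>B\<^esub> b"
      using x by (simp flip: act_mult add: act_one)
    then show "\<exists>y\<in>carrier (semidirect_product K B act).
        y \<otimes>\<^bsub>semidirect_product K B act\<^esub> x = \<one>\<^bsub>semidirect_product K B act\<^esub>"
      using x by (intro bexI[of _ ?y]) (auto simp: semidirect_product_def)
  qed (auto simp: semidirect_product_def K.m_assoc B.m_assoc act_one act_mult)
qed

lemma index_shift_in_carrier:
  assumes "group H" "group K" "k \<in> carrier K" "b \<in> carrier (sum_group (carrier K) (\<lambda>_. H))"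
  shows "index_shift K k b \<in> carrier (sum_group (carrier K) (\<lambda>_. H))"
proof -
  interpret H: group H by fact
  interpret K: group K by fact
  have b: "b \<in> carrier K \<rightarrow>\<^sub>E carrier H" "finite {i \<in> carrier K. b i \<noteq> \<one>\<^bsub>H\<^esub>}"
    using assms by (auto simp: carrier_sum_group)
  have "{i \<in> carrier K. index_shift K k b i \<noteq> \<one>\<^bsub>H\<^esub>}
      \<subseteq> (\<lambda>i. i \<otimes>\<^bsub>K\<^esub> k) ` {i \<in> carrier K. b i \<noteq> \<one>\<^bsub>H\<^esub>}"
  proof
    fix i assume i: "i \<in> {i \<in> carrier K. index_shift K k b i \<noteq> \<one>\<^bsub>H\<^esub>}"
    then have "i = (i \<otimes>\<^bsub>K\<^esub> inv\<^bsub>K\<^esub> k) \<otimes>\<^bsub>K\<^esub> k"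
      using assms by (simp add: K.m_assoc)
    then show "i \<in> (\<lambda>i. i \<otimes>\<^bsub>K\<^esub> k) ` {i \<in> carrier K. b i \<noteq> \<one>\<^bsub>H\<^esub>}"
      using i assms by (auto simp: index_shift_def)
  qed
  then have "finite {i \<in> carrier K. index_shift K k b i \<noteq> \<one>\<^bsub>H\<^esub>}"
    using b(2) finite_surj by blast
  then show ?thesis
    using b assms by (auto simp: carrier_sum_group index_shift_def)
qed

lemma group_wreath_product:
  assumes "group H" "group K"
  shows "group (wreath_product H K)"
  unfolding wreath_product_def
proof (rule group_semidirect_product)
  interpret H: group H by fact
  interpret K: group K by fact
  let ?B = "sum_group (carrier K) (\<lambda>_. H)"
  show "group K" by fact
  show "group ?B" using assms by simp
  show "index_shift K k \<in> hom ?B ?B" if "k \<in> carrier K" for k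
    using that assms
    by (auto simp: hom_def index_shift_in_carrier) (auto simp: index_shift_def fun_eq_iff)
  show "index_shift K \<one>\<^bsub>K\<^esub> b = b" if "b \<in> carrier ?B" for b
    using that assms
    by (auto simp: carrier_sum_group index_shift_def fun_eq_iff PiE_iff extensional_def)
  show "index_shift K (k \<otimes>\<^bsub>K\<^esub> l) b = index_shift K l (index_shift K k b)"
    if "k \<in> carrier K" "l \<in> carrier K" for k l b
    using that by (auto simp: index_shift_def fun_eq_iff K.inv_mult_group K.m_assoc)
qed

end

theory Submission
  imports Defs
begin

text \<open>Write \<open>n = 2 d\<close> and let \<open>y = x\<^sup>n b\<close>, where \<open>b\<close> takes a fixed value \<open>h \<noteq> 1\<close> at
  \<open>1, x, \<dots>, x\<^sup>d\<^sup>-\<^sup>1\<close> and is trivial elsewhere. Multiplying components over residue classes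
  modulo \<open>d\<close> (folding) maps \<open>G\<close> onto a semidirect product of \<open>\<langle>x\<rangle>\<close> and \<open>H\<^sup>d\<close>; there \<open>b\<close>
  becomes the constant \<open>h\<close> and hence \<open>y\<close> becomes central. Modulo \<open>n\<close>, on the other hand,
  \<open>b\<close> becomes the indicator of half a cycle, which is fixed by no nontrivial rotation;
  therefore the centralizer of \<open>y\<close> is just \<open>\<langle>y\<rangle>\<close>. The normal closure of \<open>\<langle>y\<rangle>\<close> thus lies in
  the preimage of the central subgroup generated by the image of \<open>y\<close>, and these preimages
  meet trivially as \<open>d\<close> grows, because folding is injective on elements with small support.\<close>

section \<open>Finitely supported products, normal closures and centralizers\<close>

text \<open>\<open>gfinprod\<close> multiplies over the support and is trivial if that is infinite;
  an injective \<open>g\<close> carries one support bijectively onto the other, so both cases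
  agree.\<close>

lemma (in comm_monoid) gfinprod_reindex:
  assumes "inj_on g A" "\<And>i. i \<in> A \<Longrightarrow> f (g i) \<in> carrier G"
  shows "gfinprod G (\<lambda>i. f (g i)) A = gfinprod G f (g ` A)"
proof -
  let ?B = "{i \<in> A. f (g i) \<noteq> \<one>}"
  have eq: "{i \<in> g ` A. f i \<noteq> \<one>} = g ` ?B" by auto
  have inj: "inj_on g ?B" using assms(1) by (auto intro: inj_on_subset)
  have "finprod G f (g ` ?B) = finprod G (\<lambda>i. f (g i)) ?B"
    using inj assms(2) by (intro finprod_reindex) auto
  then show ?thesis
    unfolding gfinprod_def eq finite_image_iff[OF inj] by simp
qed

lemma (in comm_monoid) gfinprod_eq_single:
  assumes "a \<in> A" "f \<in> A \<rightarrow> carrier G" "\<And>i. \<lbrakk>i \<in> A; i \<noteq> a\<rbrakk> \<Longrightarrow> f i = \<one>"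
  shows "gfinprod G f A = f a"
proof -
  have "gfinprod G f A = gfinprod G f {a}"
    using assms by (intro gfinprod_mono_neutral_cong_right) auto
  also have "\<dots> = f a"
    using assms(1,2) by (auto simp: Pi_iff)
  finally show ?thesis .
qed

lemma normal_closure_subset:
  assumes "N \<lhd> G" "S \<subseteq> N"
  shows "normal_closure G S \<subseteq> N"
  using assms unfolding normal_closure_def by blast

lemma (in group) one_in_normal_closure: "\<one> \<in> normal_closure G S"
  unfolding normal_closure_def
  by (auto dest: normal_imp_subgroup subgroup.one_closed)

lemma (in group) one_in_pseudocentre: "\<one> \<in> pseudocentre G"
  unfolding pseudocentre_def by (simp add: one_in_normal_closure)

lemma centralizer_in_carrier: "g \<in> centralizer G x \<Longrightarrow> g \<in> carrier G"
  unfolding centralizer_def by auto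

lemma (in group) centralizer_mult_closed:
  assumes "x \<in> carrier G" "g \<in> centralizer G x" "h \<in> centralizer G x"
  shows "g \<otimes> h \<in> centralizer G x"
  using assms unfolding centralizer_def by simp (metis m_assoc)

lemma (in group) int_pow_in_centralizer:
  assumes "x \<in> carrier G"
  shows "x [^] (j::int) \<in> centralizer G x"
  using assms int_pow_mult[of x j 1] int_pow_mult[of x 1 j]
  unfolding centralizer_def by (simp add: add.commute)

section \<open>Integer coordinates on the wreath product\<close>

locale infinite_cyclic_wreath = H: comm_group H + K: group K
  for H :: "('h, 'm) monoid_scheme" and K :: "('k, 'n) monoid_scheme" +
  fixes x :: 'k
  assumes x: "x \<in> carrier K" and gen: "carrier K = generate K {x}" and inf: "infinite (carrier K)"
begin

text \<open>Exponents serve as coordinates on \<open>K\<close>, so that index arithmetic becomes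
  integer arithmetic.\<close>

definition e :: "int \<Rightarrow> 'k" where "e z = x [^]\<^bsub>K\<^esub> z"

abbreviation B where "B \<equiv> sum_group (carrier K) (\<lambda>_. H)"

abbreviation G where "G \<equiv> wreath_product H K"

abbreviation sh :: "int \<Rightarrow> ('k \<Rightarrow> 'h) \<Rightarrow> ('k \<Rightarrow> 'h)" where "sh m \<equiv> index_shift K (e m)"

sublocale B: group B by simp

sublocale G: group G
  using group_wreath_product H.is_group K.is_group by blast

lemma e_carrier [simp]: "e z \<in> carrier K"
  by (simp add: e_def x)

lemma e_mult: "e a \<otimes>\<^bsub>K\<^esub> e b = e (a + b)"
  by (simp add: e_def x K.int_pow_mult)

lemma e_inv: "inv\<^bsub>K\<^esub> e a = e (- a)"
  by (simp add: e_def x K.int_pow_neg)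

lemma e_zero: "e 0 = \<one>\<^bsub>K\<^esub>"
  by (simp add: e_def)

lemma carrier_K: "carrier K = range e"
  unfolding e_def using gen K.generate_pow[OF x] by (simp add: full_SetCompr_eq)

lemma e_eq_iff [simp]: "e a = e b \<longleftrightarrow> a = b"
proof -
  have "carrier (subgroup_generated K {x}) = carrier K"
    using x gen by (simp add: carrier_subgroup_generated)
  then show ?thesis
    unfolding e_def using K.infinite_cyclic_subgroup_int[OF x] inf by auto
qed

lemma in_carrier_B_iff:
  "c \<in> carrier B \<longleftrightarrow> c \<in> extensional (carrier K) \<and> (\<forall>z. c (e z) \<in> carrier H) \<and> finite {z. c (e z) \<noteq> \<one>\<^bsub>H\<^esub>}"
proof -
  have "{i \<in> carrier K. c i \<noteq> \<one>\<^bsub>H\<^esub>} = e ` {z. c (e z) \<noteq> \<one>\<^bsub>H\<^esub>}"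
    by (auto simp: carrier_K)
  moreover have "inj_on e A" for A by (auto simp: inj_on_def)
  ultimately show ?thesis
    by (auto simp: carrier_sum_group PiE_iff finite_image_iff carrier_K)
qed

lemma B_closed [simp]: "c \<in> carrier B \<Longrightarrow> c (e z) \<in> carrier H"
  by (simp add: in_carrier_B_iff)

lemma B_finite_support: "c \<in> carrier B \<Longrightarrow> finite {z. c (e z) \<noteq> \<one>\<^bsub>H\<^esub>}"
  by (simp add: in_carrier_B_iff)

lemma B_mult_apply [simp]: "(c \<otimes>\<^bsub>B\<^esub> c') (e z) = c (e z) \<otimes>\<^bsub>H\<^esub> c' (e z)"
  by simp

lemma B_one_apply [simp]: "\<one>\<^bsub>B\<^esub> (e z) = \<one>\<^bsub>H\<^esub>"
  by simp

lemma B_eqI: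
  assumes "c \<in> carrier B" "c' \<in> carrier B" "\<And>z. c (e z) = c' (e z)"
  shows "c = c'"
proof (rule extensionalityI)
  show "c \<in> extensional (carrier K)" "c' \<in> extensional (carrier K)"
    using assms(1,2) unfolding in_carrier_B_iff by auto
qed (use assms(3) in \<open>auto simp: carrier_K\<close>)

declare mult_sum_group [simp del] one_sum_group [simp del]

lemma sh_apply [simp]: "sh m c (e z) = c (e (z - m))"
  by (simp add: index_shift_def e_inv e_mult)

lemma sh_closed [simp]: "c \<in> carrier B \<Longrightarrow> sh m c \<in> carrier B"
  using index_shift_in_carrier[OF H.is_group K.is_group] by simp

lemma carrier_G: "carrier G = carrier K \<times> carrier B"
  by (simp add: wreath_product_def semidirect_product_def)

lemma in_carrier_G [simp]: "(e m, c) \<in> carrier G \<longleftrightarrow> c \<in> carrier B"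
  by (simp add: carrier_G)

lemma carrier_GE:
  assumes "g \<in> carrier G"
  obtains m c where "g = (e m, c)" "c \<in> carrier B"
  using assms by (auto simp: carrier_G carrier_K)

lemma mult_G: "(e m, c) \<otimes>\<^bsub>G\<^esub> (e m', c') = (e (m + m'), sh m' c \<otimes>\<^bsub>B\<^esub> c')"
  by (simp add: wreath_product_def semidirect_product_def e_mult)

lemma one_G: "\<one>\<^bsub>G\<^esub> = (e 0, \<one>\<^bsub>B\<^esub>)"
  by (simp add: wreath_product_def semidirect_product_def e_zero)

lemma fst_hom: "fst \<in> hom G K"
  by (auto simp: hom_def wreath_product_def semidirect_product_def)

section \<open>Folding modulo \<open>d\<close>\<close>

text \<open>The component of the folded element at the class of \<open>r\<close>. Any integer may
  represent its class, so shifts need no reduction modulo \<open>d\<close>.\<close>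

definition residue_prod :: "int \<Rightarrow> int \<Rightarrow> ('k \<Rightarrow> 'h) \<Rightarrow> 'h"
  where "residue_prod d r c = gfinprod H (\<lambda>z. c (e z)) {z. d dvd z - r}"

lemma residue_prod_closed [simp]: "c \<in> carrier B \<Longrightarrow> residue_prod d r c \<in> carrier H"
  unfolding residue_prod_def by (intro H.gfinprod_closed) auto

lemma residue_prod_one [simp]: "residue_prod d r \<one>\<^bsub>B\<^esub> = \<one>\<^bsub>H\<^esub>"
  by (simp add: residue_prod_def gfinprod_def)

text \<open>Commutativity of \<open>H\<close> makes folding a homomorphism on the base group; finite
  supports keep all products genuine.\<close>

lemma residue_prod_mult:
  assumes "c \<in> carrier B" "c' \<in> carrier B"
  shows "residue_prod d r (c \<otimes>\<^bsub>B\<^esub> c') = residue_prod d r c \<otimes>\<^bsub>H\<^esub> residue_prod d r c'"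
  unfolding residue_prod_def B_mult_apply
  using assms
  by (intro H.gfinprod_distrib) (auto intro: finite_subset[OF _ B_finite_support])

lemma residue_prod_sh:
  assumes "c \<in> carrier B"
  shows "residue_prod d r (sh m c) = residue_prod d (r - m) c"
proof -
  have eq: "{z. d dvd z - (r - m)} = (\<lambda>z. z - m) ` {z. d dvd z - r}"
    by (auto simp: image_iff algebra_simps intro!: exI[of _ "_ + m"])
  have "residue_prod d r (sh m c) = gfinprod H (\<lambda>z. c (e (z - m))) {z. d dvd z - r}"
    by (simp add: residue_prod_def)
  also have "\<dots> = gfinprod H (\<lambda>z. c (e z)) ((\<lambda>z. z - m) ` {z. d dvd z - r})"
    using assms by (intro H.gfinprod_reindex[where f = "\<lambda>z. c (e z)"]) (auto simp: inj_on_def)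
  finally show ?thesis by (simp add: residue_prod_def eq)
qed

lemma residue_prod_cong_index:
  assumes "d dvd r - r'"
  shows "residue_prod d r c = residue_prod d r' c"
proof -
  have "d dvd z - r \<longleftrightarrow> d dvd z - r'" for z
    using assms dvd_add_right_iff[of d "r - r'" "z - r"] by simp
  then show ?thesis by (simp add: residue_prod_def)
qed

lemma residue_prod_eq_single:
  assumes "c \<in> carrier B" "d dvd a - r" "\<And>z. \<lbrakk>d dvd z - r; z \<noteq> a\<rbrakk> \<Longrightarrow> c (e z) = \<one>\<^bsub>H\<^esub>"
  shows "residue_prod d r c = c (e a)"
  unfolding residue_prod_def using assms by (intro H.gfinprod_eq_single) auto

definition block :: "int \<Rightarrow> 'h \<Rightarrow> 'k \<Rightarrow> 'h"
  where "block d h = (\<lambda>i\<in>carrier K. if i \<in> e ` {0..<d} then h else \<one>\<^bsub>H\<^esub>)"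

lemma block_apply [simp]: "block d h (e z) = (if 0 \<le> z \<and> z < d then h else \<one>\<^bsub>H\<^esub>)"
  by (auto simp: block_def)

lemma block_closed [simp]:
  assumes "h \<in> carrier H"
  shows "block d h \<in> carrier B"
proof -
  have "finite {z. block d h (e z) \<noteq> \<one>\<^bsub>H\<^esub>}"
    by (rule finite_subset[of _ "{0..<d}"]) auto
  moreover have "block d h \<in> extensional (carrier K)" by (simp add: block_def)
  ultimately show ?thesis using assms by (simp add: in_carrier_B_iff)
qed

text \<open>As \<open>d \<le> n\<close>, the block meets a class modulo \<open>n\<close> at most
  once, and only at \<open>r mod n\<close>. For \<open>n = d\<close> every component is
  \<open>h\<close>; for \<open>n = 2 * d\<close> half of them are.\<close>

lemma residue_prod_block:
  assumes "h \<in> carrier H" "0 < d" "d \<le> n"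
  shows "residue_prod n r (block d h) = (if r mod n < d then h else \<one>\<^bsub>H\<^esub>)"
proof -
  have "z = r mod n" if "n dvd z - r" "0 \<le> z" "z < d" for z
    using that assms by (metis mod_eq_dvd_iff mod_pos_pos_trivial order_less_le_trans)
  then have "residue_prod n r (block d h) = block d h (e (r mod n))"
    using assms by (intro residue_prod_eq_single) (auto simp: mod_eq_dvd_iff[symmetric])
  then show ?thesis using assms by simp
qed

section \<open>A normal subgroup obtained by folding\<close>

text \<open>Preimage of the central subgroup generated by \<open>(x\<^sup>2\<^sup>d, (h, \<dots>, h))\<close>
  under folding modulo \<open>d\<close>.\<close>

definition central_preimage :: "int \<Rightarrow> 'h \<Rightarrow> ('k \<times> ('k \<Rightarrow> 'h)) set"
  where "central_preimage d h = {(e (2 * d * j), c) | j c. c \<in> carrier B \<and> (\<forall>r. residue_prod d r c = h [^]\<^bsub>H\<^esub> j)}"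

text \<open>Rotation by a multiple of \<open>d\<close> fixes every class; this makes the folded
  \<open>x^(2 d)\<close> act trivially.\<close>

lemma residue_prod_sh_multiple:
  assumes "c \<in> carrier B" "d dvd m"
  shows "residue_prod d r (sh m c) = residue_prod d r c"
  using assms by (simp add: residue_prod_sh) (rule residue_prod_cong_index, simp)

lemma in_central_preimage_iff: "(e m, c) \<in> central_preimage d h \<longleftrightarrow>
    (\<exists>j. m = 2 * d * j \<and> c \<in> carrier B \<and> (\<forall>r. residue_prod d r c = h [^]\<^bsub>H\<^esub> j))"
  by (auto simp: central_preimage_def)

lemma central_preimage_carrier: "central_preimage d h \<subseteq> carrier G"
  by (auto simp: central_preimage_def)

lemma central_preimage_subgroup:
  assumes h: "h \<in> carrier H"
  shows "subgroup (central_preimage d h) G"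
proof (rule G.subgroupI)
  show "central_preimage d h \<subseteq> carrier G" by (rule central_preimage_carrier)
  have "\<one>\<^bsub>G\<^esub> \<in> central_preimage d h"
    by (auto simp: one_G in_central_preimage_iff intro!: exI[of _ 0])
  then show "central_preimage d h \<noteq> {}" by blast
next
  fix g assume g: "g \<in> central_preimage d h"
  then obtain j c where gj: "g = (e (2 * d * j), c)" "c \<in> carrier B" "\<And>r. residue_prod d r c = h [^]\<^bsub>H\<^esub> j"
    by (auto simp: central_preimage_def)
  have "inv\<^bsub>G\<^esub> g \<in> carrier G" using g central_preimage_carrier by blast
  then obtain m v where mv: "inv\<^bsub>G\<^esub> g = (e m, v)" "v \<in> carrier B" by (rule carrier_GE)
  \<comment> \<open>Folding this equation determines the inverse without an explicit
    formula.\<close>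
  have "inv\<^bsub>G\<^esub> g \<otimes>\<^bsub>G\<^esub> g = \<one>\<^bsub>G\<^esub>" using g central_preimage_carrier by (intro G.l_inv) blast
  then have m: "m = 2 * d * (- j)" and v: "sh (2 * d * j) v \<otimes>\<^bsub>B\<^esub> c = \<one>\<^bsub>B\<^esub>"
    unfolding mv gj(1)[symmetric] one_G
    by (auto simp: gj(1) mult_G)
  have "residue_prod d r v = h [^]\<^bsub>H\<^esub> (- j)" for r
  proof -
    have "residue_prod d r v \<otimes>\<^bsub>H\<^esub> h [^]\<^bsub>H\<^esub> j = \<one>\<^bsub>H\<^esub>"
      using arg_cong[OF v, of "residue_prod d r"] mv gj by (simp add: residue_prod_mult residue_prod_sh_multiple)
    then show ?thesis using h mv by (simp add: H.int_pow_neg H.inv_equality)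
  qed
  then show "inv\<^bsub>G\<^esub> g \<in> central_preimage d h"
    unfolding mv(1) in_central_preimage_iff using mv m by blast
next
  fix g g' assume "g \<in> central_preimage d h" "g' \<in> central_preimage d h"
  then obtain j c j' c' where
    g: "g = (e (2 * d * j), c)" "c \<in> carrier B" "\<And>r. residue_prod d r c = h [^]\<^bsub>H\<^esub> j" and
    g': "g' = (e (2 * d * j'), c')" "c' \<in> carrier B" "\<And>r. residue_prod d r c' = h [^]\<^bsub>H\<^esub> j'"
    by (auto simp: central_preimage_def)
  have "2 * d * j + 2 * d * j' = 2 * d * (j + j')" by (simp add: algebra_simps)
  moreover have "residue_prod d r (sh (2 * d * j') c \<otimes>\<^bsub>B\<^esub> c') = h [^]\<^bsub>H\<^esub> (j + j')" for r
    using g g' h by (simp add: residue_prod_mult residue_prod_sh_multiple H.int_pow_mult)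
  ultimately show "g \<otimes>\<^bsub>G\<^esub> g' \<in> central_preimage d h"
    using g(2) g'(2) unfolding g(1) g'(1) mult_G in_central_preimage_iff
    by (intro exI[of _ "j + j'"]) simp
qed

text \<open>Conjugation keeps the exponent of \<open>x\<close> because \<open>K\<close> is abelian,
  and keeps the folded base part because it is constant on classes and commutes with that of
  \<open>u\<close>.\<close>

lemma central_preimage_normal:
  assumes h: "h \<in> carrier H"
  shows "central_preimage d h \<lhd> G"
proof (rule G.normal_invI[OF central_preimage_subgroup[OF h]])
  fix y g assume y: "y \<in> carrier G" and g: "g \<in> central_preimage d h"
  obtain k u where ku: "y = (e k, u)" "u \<in> carrier B" using y by (rule carrier_GE)
  obtain j c where gj: "g = (e (2 * d * j), c)" "c \<in> carrier B" "\<And>r. residue_prod d r c = h [^]\<^bsub>H\<^esub> j"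
    using g by (auto simp: central_preimage_def)
  have gG: "g \<in> carrier G" using g central_preimage_carrier by blast
  define p where "p = y \<otimes>\<^bsub>G\<^esub> g \<otimes>\<^bsub>G\<^esub> inv\<^bsub>G\<^esub> y"
  have "p \<in> carrier G" using y gG by (simp add: p_def)
  then obtain m v where mv: "p = (e m, v)" "v \<in> carrier B" by (rule carrier_GE)
  have "p \<otimes>\<^bsub>G\<^esub> y = y \<otimes>\<^bsub>G\<^esub> g" using y gG by (simp add: p_def G.m_assoc)
  then have m: "m = 2 * d * j"
    and v: "sh k v \<otimes>\<^bsub>B\<^esub> u = sh (2 * d * j) u \<otimes>\<^bsub>B\<^esub> c"
    unfolding mv ku(1) gj(1) mult_G by auto
  have "residue_prod d r v = h [^]\<^bsub>H\<^esub> j" for r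
  proof -
    \<comment> \<open>Class \<open>r + k\<close> is used because \<open>sh k\<close> moves class
      \<open>r\<close> there.\<close>
    have "residue_prod d r v \<otimes>\<^bsub>H\<^esub> residue_prod d (r + k) u = residue_prod d (r + k) u \<otimes>\<^bsub>H\<^esub> h [^]\<^bsub>H\<^esub> j"
      using arg_cong[OF v, of "residue_prod d (r + k)"] mv ku gj
      by (simp add: residue_prod_mult residue_prod_sh_multiple) (simp add: residue_prod_sh)
    then show ?thesis using h mv ku by (simp add: H.m_comm[of "residue_prod d (r + k) u"])
  qed
  then show "y \<otimes>\<^bsub>G\<^esub> g \<otimes>\<^bsub>G\<^esub> inv\<^bsub>G\<^esub> y \<in> central_preimage d h" using mv m by (auto simp: in_central_preimage_iff simp flip: p_def)
qed

section \<open>The centralizer of the chosen element\<close>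

text \<open>A nontrivial component would recur at all \<open>z - i * n\<close>, contradicting finite
  support.\<close>

lemma shift_invariant_imp_one:
  assumes c: "c \<in> carrier B" and "n \<noteq> 0" and inv: "sh n c = c"
  shows "c = \<one>\<^bsub>B\<^esub>"
proof (rule B_eqI)
  fix z
  show "c (e z) = \<one>\<^bsub>B\<^esub> (e z)"
  proof (rule ccontr)
    assume "c (e z) \<noteq> \<one>\<^bsub>B\<^esub> (e z)"
    then have z: "c (e z) \<noteq> \<one>\<^bsub>H\<^esub>" by simp
    have per: "c (e (w - n)) = c (e w)" for w
      using sh_apply[of n c w] inv by simp
    have "c (e (z - int i * n)) = c (e z)" for i
    proof (induction i)
      case (Suc i)
      then show ?case using per[of "z - int i * n"] by (simp add: algebra_simps)
    qed simp
    then have "range (\<lambda>i. z - int i * n) \<subseteq> {z. c (e z) \<noteq> \<one>\<^bsub>H\<^esub>}" using z by auto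
    then have "finite (range (\<lambda>i. z - int i * n))"
      using B_finite_support[OF c] finite_subset by blast
    moreover have "inj (\<lambda>i. z - int i * n)" using \<open>n \<noteq> 0\<close> by (auto simp: inj_on_def)
    ultimately show False using finite_imageD infinite_UNIV_nat by blast
  qed
qed (use c in auto)

text \<open>Let \<open>t = m mod (2 * d)\<close> be nonzero. Then \<open>r = 0\<close> forces
  \<open>d < t\<close>, whereas \<open>r = m\<close> forces \<open>t < d\<close>.\<close>

lemma half_cycle_rotation:
  fixes d m :: int
  assumes "0 < d" and inv: "\<And>r. (r - m) mod (2 * d) < d \<longleftrightarrow> r mod (2 * d) < d"
  shows "2 * d dvd m"
proof (rule ccontr)
  assume "\<not> 2 * d dvd m"
  then have "m mod (2 * d) \<noteq> 0" by (simp add: dvd_eq_mod_eq_0)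
  then have "(- m) mod (2 * d) = 2 * d - m mod (2 * d)"
    by (simp add: zmod_zminus1_eq_if)
  then show False using inv[of 0] inv[of m] \<open>0 < d\<close> by simp
qed

lemma centralizer_subset_central_preimage:
  assumes h: "h \<in> carrier H" "h \<noteq> \<one>\<^bsub>H\<^esub>" and d: "0 < d"
  shows "centralizer G (e (2 * d), block d h) \<subseteq> central_preimage d h"
proof
  let ?y = "(e (2 * d), block d h)"
  have yG: "?y \<in> carrier G" using h by simp
  \<comment> \<open>The witness is \<open>j = 1\<close>: modulo \<open>d\<close> each class contains
    exactly one index of the block.\<close>
  have yN: "?y \<in> central_preimage d h"
    using h d by (auto simp: in_central_preimage_iff residue_prod_block intro!: exI[of _ 1])
  have comm: "sh (2 * d) c \<otimes>\<^bsub>B\<^esub> block d h = sh m (block d h) \<otimes>\<^bsub>B\<^esub> c"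
    if "(e m, c) \<in> centralizer G ?y" for m c
    using that by (simp add: centralizer_def mult_G)
  fix g assume g: "g \<in> centralizer G ?y"
  then have gG: "g \<in> carrier G" by (rule centralizer_in_carrier)
  then obtain m c where mc: "g = (e m, c)" "c \<in> carrier B" by (rule carrier_GE)
  \<comment> \<open>Modulo \<open>2 * d\<close> the shift of \<open>c\<close> disappears, so
    \<open>c\<close> cancels from the folded commutation relation.\<close>
  have "residue_prod (2 * d) (r - m) (block d h) = residue_prod (2 * d) r (block d h)" for r
  proof -
    have "residue_prod (2 * d) r c \<otimes>\<^bsub>H\<^esub> residue_prod (2 * d) r (block d h)
        = residue_prod (2 * d) (r - m) (block d h) \<otimes>\<^bsub>H\<^esub> residue_prod (2 * d) r c"
      using arg_cong[OF comm[OF g[unfolded mc]], of "residue_prod (2 * d) r"] mc h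
      by (simp add: residue_prod_mult residue_prod_sh_multiple) (simp add: residue_prod_sh)
    then show ?thesis
      using mc h by (simp add: H.m_comm[of "residue_prod (2 * d) r c"])
  qed
  \<comment> \<open>Since \<open>h\<close> is not the identity, equal components mean equal
    membership in the half cycle.\<close>
  then have "(r - m) mod (2 * d) < d \<longleftrightarrow> r mod (2 * d) < d" for r
    using h d by (force simp: residue_prod_block split: if_splits)
  then obtain j where j: "m = 2 * d * j"
    using half_cycle_rotation[OF d] by blast
  \<comment> \<open>Dividing off the power of \<open>?y\<close> with the same \<open>K\<close>-part
    leaves an element of the base group that still centralizes \<open>?y\<close>.\<close>
  define p where "p = g \<otimes>\<^bsub>G\<^esub> ?y [^]\<^bsub>G\<^esub> (- j)"
  have pC: "p \<in> centralizer G ?y"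
    unfolding p_def using yG g by (intro G.centralizer_mult_closed G.int_pow_in_centralizer)
  then have "p \<in> carrier G" by (rule centralizer_in_carrier)
  then obtain l c' where lc: "p = (e l, c')" "c' \<in> carrier B" by (rule carrier_GE)
  have "fst p = e m \<otimes>\<^bsub>K\<^esub> e (2 * d) [^]\<^bsub>K\<^esub> (- j)"
    using hom_mult[OF fst_hom gG, of "?y [^]\<^bsub>G\<^esub> (- j)"] hom_int_pow[OF fst_hom yG, of "- j"] yG mc
    by (simp add: p_def)
  also have "\<dots> = e 0"
    unfolding j by (simp add: e_def x K.int_pow_pow flip: K.int_pow_mult)
  finally have l: "l = 0" using lc by simp
  have sh0: "sh 0 (block d h) = block d h"
    using h by (intro B_eqI) auto
  have c'_comm: "c' \<otimes>\<^bsub>B\<^esub> block d h = block d h \<otimes>\<^bsub>B\<^esub> c'"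
    using lc h by (intro B_eqI) (auto intro: H.m_comm)
  \<comment> \<open>Cancelling the block shows that \<open>c'\<close> is invariant under
    \<open>sh (2 * d)\<close>, hence trivial.\<close>
  have "sh (2 * d) c' \<otimes>\<^bsub>B\<^esub> block d h = c' \<otimes>\<^bsub>B\<^esub> block d h"
    using comm[of l c'] pC lc l sh0 c'_comm by simp
  then have "c' = \<one>\<^bsub>B\<^esub>"
    using lc h d by (intro shift_invariant_imp_one[of _ "2 * d"]) auto
  then have "p = \<one>\<^bsub>G\<^esub>" using lc l by (simp add: one_G)
  then have "g = ?y [^]\<^bsub>G\<^esub> j"
    using gG yG unfolding p_def by (simp add: G.int_pow_neg G.inv_solve_right')
  then show "g \<in> central_preimage d h"
    using G.subgroup_int_pow_closed[OF central_preimage_subgroup[OF h(1)] yN] by simp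
qed

section \<open>Intersection over all \<open>d\<close>\<close>

lemma pseudocentre_subset_central_preimage:
  assumes "h \<in> carrier H" "h \<noteq> \<one>\<^bsub>H\<^esub>" "0 < d"
  shows "pseudocentre G \<subseteq> central_preimage d h"
proof -
  have "(e (2 * d), block d h) \<in> carrier G" using assms by simp
  then have "pseudocentre G \<subseteq> normal_closure G (centralizer G (e (2 * d), block d h))"
    unfolding pseudocentre_def by (rule INF_lower)
  also have "\<dots> \<subseteq> central_preimage d h"
    using assms by (intro normal_closure_subset central_preimage_normal centralizer_subset_central_preimage)
  finally show ?thesis .
qed

text \<open>For large \<open>d\<close>, divisibility forces \<open>m = 0\<close> and thus
  \<open>j = 0\<close>, and each class meets the support of \<open>c\<close> at most once, so every
  component is a folded one and equals \<open>h^0\<close>.\<close>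

lemma in_all_central_preimage_imp_one:
  assumes g: "\<And>d. 0 < d \<Longrightarrow> g \<in> central_preimage d h"
  shows "g = \<one>\<^bsub>G\<^esub>"
proof -
  have "g \<in> carrier G" using g[of 1] central_preimage_carrier by auto
  then obtain m c where mc: "g = (e m, c)" "c \<in> carrier B" by (rule carrier_GE)
  \<comment> \<open>Inserting 0 keeps the maximum meaningful when the support is empty.\<close>
  define s where "s = Max (insert 0 (abs ` {z. c (e z) \<noteq> \<one>\<^bsub>H\<^esub>}))"
  have s: "\<bar>z\<bar> \<le> s" if "c (e z) \<noteq> \<one>\<^bsub>H\<^esub>" for z
    unfolding s_def using that B_finite_support[OF mc(2)] by (intro Max_ge) auto
  \<comment> \<open>Support indices differ by at most \<open>2 * s\<close>, so distinct ones are
    incongruent modulo \<open>d\<close>; also \<open>d\<close> exceeds the absolute value of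
    \<open>m\<close>.\<close>
  define d where "d = 2 * \<bar>s\<bar> + \<bar>m\<bar> + 1"
  have d: "0 < d" by (simp add: d_def)
  obtain j where j: "m = 2 * d * j" "\<And>r. residue_prod d r c = h [^]\<^bsub>H\<^esub> j"
    using g[OF d] by (auto simp: mc in_central_preimage_iff)
  have "d dvd m" using j by simp
  then have "m = 0"
    using dvd_imp_le_int[of m d] unfolding d_def by linarith
  with j d have "residue_prod d r c = \<one>\<^bsub>H\<^esub>" for r by simp
  moreover have "residue_prod d z c = c (e z)" if z: "c (e z) \<noteq> \<one>\<^bsub>H\<^esub>" for z
  proof (rule residue_prod_eq_single[OF mc(2)])
    fix w assume w: "d dvd w - z" "w \<noteq> z"
    then have "d \<le> \<bar>w - z\<bar>" using dvd_imp_le_int[of "w - z" d] d by simp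
    then show "c (e w) = \<one>\<^bsub>H\<^esub>" using s[OF z] s[of w] unfolding d_def by linarith
  qed simp
  ultimately have "c (e z) = \<one>\<^bsub>H\<^esub>" for z by metis
  then have "c = \<one>\<^bsub>B\<^esub>" using mc by (intro B_eqI) auto
  then show ?thesis using mc \<open>m = 0\<close> by (simp add: one_G)
qed

end

theorem theorem5p30:
  fixes H :: "('h, 'm) monoid_scheme" and K :: "('k, 'n) monoid_scheme" and x :: 'k
  assumes "comm_group H" and "\<not> trivial_group H"
    and "group K" and "x \<in> carrier K" and "carrier K = generate K {x}" and "infinite (carrier K)"
  shows "pseudocentre (wreath_product H K) = {\<one>\<^bsub>wreath_product H K\<^esub>}"
proof -
  interpret infinite_cyclic_wreath H K x
    using assms by (simp add: infinite_cyclic_wreath_def infinite_cyclic_wreath_axioms_def)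
  obtain h where "h \<in> carrier H" "h \<noteq> \<one>\<^bsub>H\<^esub>"
    using assms(2) H.trivial_group_subset by auto
  then show ?thesis
    using pseudocentre_subset_central_preimage in_all_central_preimage_imp_one G.one_in_pseudocentre by blast
qed

end
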